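(* Let $n\ge 1$. If $n$ is odd, then for every partition $\lambda$ of $n$ other than $(n)$ and $(1,1,\dots,1)$ there exists an almost cyclic permutation $\sigma$ of $\{1,\dots,n\}$ with $\Gamma(P(\sigma))=\lambda$. If $n$ is even, then for every partition $\lambda$ of $n$ other than $(n)$, $(1,1,\dots,1)$ and $(\frac n2,\frac n2)$ there exists an almost cyclic permutation $\sigma$ of $\{1,\dots,n\}$ with $\Gamma(P(\sigma))=\lambda$.
   Context: A permutation of $\{1,\dots,n\}$ is almost cyclic if its cycle type is $(n-1,1)$, i.e. it consists of one cycle of length $n-1$ and one fixed point. Permutations are written as sequences $\sigma=(\sigma_1,\dots,\sigma_n)$. For a finite sequence $\sigma$ of distinct integers, $P(\sigma)$ is the Robinson--Schensted--Knuth insertion tableau obtained by inserting $\sigma_1,\sigma_2,\dots$ in order by Schensted row insertion (to insert $a$ into row $r$: if row $r$ is empty or $a$ exceeds every entry of row $r$, append $a$ and stop; otherwise replace the leftmost entry $b>a$ of row $r$ by $a$ and insert $b$ into row $r+1$). $\Gamma(P(\sigma))$ is the shape of $P(\sigma)$, its row lengths in nonincreasing order. *)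

theory Defs
  imports "HOL-Combinatorics.Combinatorics"
begin

definition cycle_type :: "('a \<Rightarrow> 'a) \<Rightarrow> 'a set \<Rightarrow> nat multiset" where
  "cycle_type p S = image_mset card (mset_set (orbit p ` S))"

definition almost_cyclic :: "nat \<Rightarrow> (nat \<Rightarrow> nat) \<Rightarrow> bool" where
  "almost_cyclic n p \<longleftrightarrow> p permutes {1..n} \<and> cycle_type p {1..n} = {#n - 1, 1#}"

definition one_line :: "nat \<Rightarrow> (nat \<Rightarrow> nat) \<Rightarrow> nat list" where
  "one_line n p = map p [1..<Suc n]"

text \<open>The second component of the result is the entry bumped into the next row, if any.\<close>

fun row_insert :: "'a::linorder \<Rightarrow> 'a list \<Rightarrow> 'a list \<times> 'a option" where
  "row_insert a [] = ([a], None)"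
| "row_insert a (b # bs) =
     (if a < b then (a # bs, Some b)
      else (case row_insert a bs of (r, c) \<Rightarrow> (b # r, c)))"

fun tableau_insert :: "'a::linorder \<Rightarrow> 'a list list \<Rightarrow> 'a list list" where
  "tableau_insert a [] = [[a]]"
| "tableau_insert a (r # rs) =
     (case row_insert a r of
        (r', None) \<Rightarrow> r' # rs
      | (r', Some b) \<Rightarrow> r' # tableau_insert b rs)"

definition insertion_tableau :: "'a::linorder list \<Rightarrow> 'a list list" where
  "insertion_tableau xs = fold tableau_insert xs []"

text \<open>Rows are listed from the first one on; for insertion tableaux their lengths
  are automatically nonincreasing.\<close>

definition shape :: "'a list list \<Rightarrow> nat list" where
  "shape T = map length T"

definition is_partition_of :: "nat list \<Rightarrow> nat \<Rightarrow> bool" where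
  "is_partition_of l n \<longleftrightarrow> sorted_wrt (\<ge>) l \<and> (\<forall>k \<in> set l. k > 0) \<and> sum_list l = n"

end

theory Submission
  imports Defs
begin

text \<open>
  Permutations are built column by column. To add a column of height \<open>k\<close> to a permutation of
  \<open>{1..n}\<close>, redirect one edge \<open>i \<rightarrow> p i\<close> of its long cycle through the new points
  \<open>n + 1, \<dots>, n + k\<close>: position \<open>i\<close> receives a letter \<open>n + a\<close>, the new positions receive the other
  new letters in decreasing order, and \<open>p i\<close> comes last. For \<open>a\<close> near \<open>k / 2\<close> the new points form a
  single path, or a path and a fixed point. If \<open>p i = n\<close> and \<open>a < k\<close>, inserting the decreasing
  block lengthens each of the first \<open>k\<close> rows by one. For \<open>k = 1\<close> one splices at \<open>i = n\<close> instead, which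
  lengthens the first row as long as the word ends in a descent.

  Hence it suffices to realize two of the columns. Columns of heights \<open>c \<ge> 1\<close> and \<open>k \<ge> 3\<close> arise by
  splicing at position 1 of a suitable cycle on \<open>{1..c}\<close>, leaving a fixed point in the
  new block, and columns of heights 2 and 1 by the word \<open>1 3 2\<close>. Only one row, one column and two
  equal rows lack such a pair.
\<close>

section \<open>Cycles\<close>

text \<open>\<open>xs\<close> lists one cycle in order; phrasing this with \<open>rotate1\<close>
  lets cycles be cut and glued by list algebra. A one-element list is a fixed point.\<close>

definition cycle_list :: "('a \<Rightarrow> 'a) \<Rightarrow> 'a list \<Rightarrow> bool" where
  "cycle_list p xs \<longleftrightarrow> distinct xs \<and> xs \<noteq> [] \<and> map p xs = rotate1 xs"

lemma cycle_list_swap: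
  assumes "cycle_list p (us @ vs)"
  shows "cycle_list p (vs @ us)"
proof -
  have "map p (rotate (length us) (us @ vs)) = rotate1 (rotate (length us) (us @ vs))"
    using assms by (simp add: cycle_list_def rotate_map[symmetric] rotate1_rotate_swap)
  then show ?thesis
    using assms by (auto simp: cycle_list_def rotate_append)
qed

text \<open>Cutting the cycle right after \<open>i\<close> prepares for appending new points behind
  \<open>i\<close>.\<close>

lemma cycle_list_ending_in:
  assumes "cycle_list p xs" "i \<in> set xs"
  obtains ys where "cycle_list p (ys @ [i])" "set (ys @ [i]) = set xs"
proof -
  obtain us vs where "xs = us @ i # vs"
    using split_list[OF assms(2)] by blast
  then have "cycle_list p (vs @ us @ [i])" "set ((vs @ us) @ [i]) = set xs"
    using assms cycle_list_swap[of p "us @ [i]" vs] by auto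
  then show ?thesis
    using that[of "vs @ us"] by simp
qed

lemma cycle_list_funpow:
  assumes "cycle_list p xs"
  shows "map (p ^^ m) xs = rotate m xs"
proof (induction m)
  case (Suc m)
  have "map (p ^^ Suc m) xs = map p (map (p ^^ m) xs)" by simp
  also have "\<dots> = rotate m (map p xs)" using Suc by (simp add: rotate_map)
  also have "\<dots> = rotate (Suc m) xs"
    using assms by (simp add: cycle_list_def rotate1_rotate_swap)
  finally show ?case .
qed simp

lemma orbit_cycle_list:
  assumes "cycle_list p xs" "x \<in> set xs"
  shows "orbit p x = set xs"
proof -
  obtain ys where ys: "cycle_list p (ys @ [x])" "set (ys @ [x]) = set xs"
    using cycle_list_ending_in[OF assms] .
  then have zs: "cycle_list p (x # ys)"
    using cycle_list_swap[of p ys "[x]"] by simp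
  define zs where "zs = x # ys"
  have nth: "(p ^^ m) x = zs ! (m mod length zs)" for m
  proof -
    have "(p ^^ m) x = hd (map (p ^^ m) zs)" by (simp add: zs_def)
    also have "\<dots> = zs ! (m mod length zs)"
      using cycle_list_funpow[OF zs] by (simp add: zs_def hd_rotate_conv_nth)
    finally show ?thesis .
  qed
  have "y \<in> orbit p x" if "y \<in> set zs" for y
  proof -
    obtain j where j: "j < length zs" "y = zs ! j"
      using \<open>y \<in> set zs\<close> by (auto simp: in_set_conv_nth)
    \<comment> \<open>\<open>orbit\<close> only collects iterates with positive exponent; the extra
      full turn covers \<open>j = 0\<close>.\<close>
    then have "y = (p ^^ (j + length zs)) x" using nth by simp
    then show ?thesis
      using j by (auto simp: orbit_altdef intro!: exI[of _ "j + length zs"])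
  qed
  moreover have "orbit p x \<subseteq> set zs"
  proof -
    have "0 < length zs" by (simp add: zs_def)
    then show ?thesis by (auto simp: orbit_altdef nth)
  qed
  ultimately show ?thesis
    using ys(2) by (auto simp: zs_def)
qed

text \<open>\<open>p\<close> is left arbitrary outside \<open>{1..n}\<close>, so splicing need not
  control it there. Since \<open>xs\<close> is nonempty and avoids \<open>f\<close>, this forces
  \<open>2 \<le> n\<close>.\<close>

definition fixes_and_cycles :: "nat \<Rightarrow> (nat \<Rightarrow> nat) \<Rightarrow> bool" where
  "fixes_and_cycles n p \<longleftrightarrow> (\<exists>f xs. cycle_list p xs \<and> f \<notin> set xs \<and> p f = f \<and> insert f (set xs) = {1..n})"

lemma fixes_and_cycles_image:
  assumes "fixes_and_cycles n p"
  shows "p ` {1..n} = {1..n}"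
proof -
  obtain f xs where *: "cycle_list p xs" "p f = f" "insert f (set xs) = {1..n}"
    using assms by (auto simp: fixes_and_cycles_def)
  have "p ` set xs = set xs"
    using *(1) by (metis cycle_list_def list.set_map set_rotate1)
  then show ?thesis
    using *(2,3) by (metis image_insert)
qed

lemma fixes_and_cycles_inj:
  assumes "fixes_and_cycles n p"
  shows "inj_on p {1..n}"
  using fixes_and_cycles_image[OF assms] by (intro eq_card_imp_inj_on) auto

lemma almost_cyclic_if_fixes_and_cycles:
  assumes "fixes_and_cycles n p"
  obtains \<sigma> where "almost_cyclic n \<sigma>" "one_line n \<sigma> = one_line n p"
proof
  define \<sigma> where "\<sigma> i = (if i \<in> {1..n} then p i else i)" for i
  obtain f xs where *: "cycle_list p xs" "f \<notin> set xs" "p f = f" "insert f (set xs) = {1..n}"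
    using assms by (auto simp: fixes_and_cycles_def)
  have xs: "cycle_list \<sigma> xs"
  proof -
    have "map \<sigma> xs = map p xs"
      using *(4) by (intro map_cong) (auto simp: \<sigma>_def)
    then show ?thesis using *(1) unfolding cycle_list_def by metis
  qed
  have f: "\<sigma> f = f" using *(3) by (simp add: \<sigma>_def)
  have "bij_betw p {1..n} {1..n}"
    using fixes_and_cycles_inj[OF assms] fixes_and_cycles_image[OF assms]
    by (simp add: bij_betw_def)
  then have "bij_betw \<sigma> {1..n} {1..n}"
    by (rule bij_betw_cong[THEN iffD1, rotated]) (simp add: \<sigma>_def)
  then have "\<sigma> permutes {1..n}"
    by (rule bij_imp_permutes) (auto simp: \<sigma>_def)
  moreover have "orbit \<sigma> ` {1..n} = {set xs, {f}}"
  proof -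
    have "orbit \<sigma> ` {1..n} = insert (orbit \<sigma> f) (orbit \<sigma> ` set xs)"
      using *(4) by (metis image_insert)
    also have "orbit \<sigma> f = {f}" using f orbit_eq_singleton_iff by metis
    also have "orbit \<sigma> ` set xs = {set xs}"
      using orbit_cycle_list[OF xs] xs by (auto simp: cycle_list_def image_iff neq_Nil_conv)
    finally show ?thesis by auto
  qed
  moreover have "set xs \<noteq> {f}" using *(2) by auto
  moreover have "card (set xs) = n - 1"
    using *(2,4) by (metis List.finite_set card_atLeastAtMost card_insert_disjoint diff_Suc_1)
  ultimately show "almost_cyclic n \<sigma>"
    by (simp add: almost_cyclic_def cycle_type_def)
  show "one_line n \<sigma> = one_line n p"
    by (auto simp: one_line_def \<sigma>_def)
qed

section \<open>Splicing a path into a cycle\<close>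

text \<open>The decreasing bijection from \<open>{1..k}\<close> onto \<open>{0..k} - {a}\<close>.\<close>

definition gap :: "nat \<Rightarrow> nat \<Rightarrow> nat \<Rightarrow> nat" where
  "gap k a j = (if a < k + 1 - j then k + 1 - j else k - j)"

text \<open>\<open>Q\<close> runs from \<open>a\<close> to \<open>k\<close>, from where \<open>gap k a\<close> leaves \<open>{1..k}\<close> by going to \<open>0\<close>.\<close>

definition gap_path :: "nat \<Rightarrow> nat \<Rightarrow> nat list \<Rightarrow> bool" where
  "gap_path k a Q \<longleftrightarrow> distinct Q \<and> set Q \<subseteq> {1..k} \<and> Q \<noteq> [] \<and> hd Q = a \<and> last Q = k \<and>
     map (gap k a) (butlast Q) = tl Q"

text \<open>For \<open>j\<close> in \<open>{1..k}\<close>,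
  \<open>gap (k + 2) (a + 1) (j + 1) = gap k a j + 1\<close>. Thus the old exit from
  \<open>k\<close> to \<open>0\<close> becomes a step from \<open>k + 1\<close> to \<open>1\<close>,
  and \<open>1\<close> goes on to the new endpoint \<open>k + 2\<close>.\<close>

lemma gap_path_step:
  assumes "gap_path k a Q"
  shows "gap_path (k + 2) (a + 1) (map Suc Q @ [1, k + 2])"
proof -
  have Q: "distinct Q" "set Q \<subseteq> {1..k}" "Q \<noteq> []" "hd Q = a" "last Q = k"
    "map (gap k a) (butlast Q) = tl Q"
    using assms by (auto simp: gap_path_def)
  have a: "1 \<le> a" "a \<le> k" using Q(2-4) hd_in_set[of Q] by auto
  obtain Q' where Q': "Q = Q' @ [k]"
    using Q(3,5) by (metis append_butlast_last_id)
  have "map (gap (k + 2) (a + 1)) (map Suc Q') = map Suc (map (gap k a) Q')"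
    using Q(2) Q' by (fastforce simp: gap_def Suc_diff_le)
  also have "\<dots> = map Suc (tl Q)" using Q(6) by (simp only: Q' butlast_snoc)
  finally have "map (gap (k + 2) (a + 1)) (map Suc Q') = map Suc (tl Q)" .
  moreover have "gap (k + 2) (a + 1) (Suc k) = 1" "gap (k + 2) (a + 1) 1 = k + 2"
    using a by (auto simp: gap_def)
  moreover have "butlast (map Suc Q @ [1, k + 2]) = map Suc Q' @ [Suc k, 1]"
    by (simp add: Q' butlast_append)
  ultimately have "map (gap (k + 2) (a + 1)) (butlast (map Suc Q @ [1, k + 2]))
      = map Suc (tl Q) @ [1, k + 2]"
    by (simp only: map_append list.map)
  also have "\<dots> = tl (map Suc Q @ [1, k + 2])"
    using Q(3) by (cases Q) auto
  finally show ?thesis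
    unfolding gap_path_def
    using Q by (auto simp: distinct_map hd_append hd_map)
qed

text \<open>\<open>gap_path_step\<close> climbs by two, so each parity has its own base. A path
  through the whole block creates no further cycle; \<open>a < k\<close> keeps \<open>n + a\<close>
  below the first new letter \<open>n + k\<close>.\<close>

lemma ex_gap_path:
  assumes "1 \<le> k"
  shows "\<exists>a Q. gap_path k a Q \<and> set Q = {1..k} \<and> (2 \<le> k \<longrightarrow> a < k)"
  using assms
proof (induction k rule: less_induct)
  case (less k)
  have "k = 1 \<or> k = 2 \<or> k = (k - 2) + 2 \<and> 1 \<le> k - 2"
    using less.prems by arith
  then consider "k = 1" | "k = 2" | m where "k = m + 2" "1 \<le> m" by metis
  then show ?case
  proof cases
    case 1
    then show ?thesis
      by (intro exI[of _ 1] exI[of _ "[1]"]) (auto simp: gap_path_def)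
  next
    case 2
    then show ?thesis
      by (intro exI[of _ 1] exI[of _ "[1, 2]"]) (auto simp: gap_path_def gap_def)
  next
    case 3
    then obtain a Q where aQ: "gap_path m a Q" "set Q = {1..m}"
      using less.IH[of m] by auto
    then have "a \<le> m" using hd_in_set[of Q] by (auto simp: gap_path_def)
    moreover have "set (map Suc Q @ [1, m + 2]) = {1..m + 2}"
    proof -
      have "set (map Suc Q) = {2..m + 1}" using aQ(2) by (simp add: image_Suc_atLeastAtMost numeral_2_eq_2)
      then show ?thesis by auto
    qed
    ultimately show ?thesis
      using gap_path_step[OF aQ(1)] 3(1)
      by (intro exI[of _ "a + 1"] exI[of _ "map Suc Q @ [1, m + 2]"]) auto
  qed
qed

text \<open>The same induction from 3 and 4, the fixed point moving up by one in each step.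
  \<open>h < k\<close> keeps it away from position \<open>k\<close>, whose value splicing
  replaces.\<close>

lemma ex_gap_path_fixing:
  assumes "3 \<le> k"
  shows "\<exists>a Q h. gap_path k a Q \<and> a < k \<and> h < k \<and> h \<notin> set Q \<and> gap k a h = h \<and>
           insert h (set Q) = {1..k}"
  using assms
proof (induction k rule: less_induct)
  case (less k)
  have "k = 3 \<or> k = 4 \<or> k = (k - 2) + 2 \<and> 3 \<le> k - 2"
    using less.prems by arith
  then consider "k = 3" | "k = 4" | m where "k = m + 2" "3 \<le> m" by metis
  then show ?case
  proof cases
    case 1
    then show ?thesis
      by (intro exI[of _ 1] exI[of _ "[1, 3]"] exI[of _ 2]) (auto simp: gap_path_def gap_def)
  next
    case 2
    then show ?thesis
      by (intro exI[of _ 3] exI[of _ "[3, 1, 4]"] exI[of _ 2]) (auto simp: gap_path_def gap_def)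
  next
    case 3
    then obtain a Q h where aQ: "gap_path m a Q" "a < m" "h < m" "h \<notin> set Q" "gap m a h = h"
      "insert h (set Q) = {1..m}"
      using less.IH[of m] by auto
    have "Suc ` {1..m} = {2..m + 1}" by (simp add: image_Suc_atLeastAtMost numeral_2_eq_2)
    then have "insert (h + 1) (set (map Suc Q)) = {2..m + 1}" using aQ(6)
      by (metis Suc_eq_plus1 image_insert list.set_map)
    then have "insert (h + 1) (set (map Suc Q @ [1, m + 2])) = insert 1 (insert (m + 2) {2..m + 1})" by auto
    also have "\<dots> = {1..m + 2}" by auto
    finally have "insert (h + 1) (set (map Suc Q @ [1, m + 2])) = {1..m + 2}" .
    moreover have "gap (m + 2) (a + 1) (h + 1) = h + 1" "h + 1 \<notin> set (map Suc Q @ [1, m + 2])"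
      using aQ(3-6) by (auto simp: gap_def split: if_splits)
    ultimately show ?thesis
      using gap_path_step[OF aQ(1)] 3(1) aQ(2,3)
      by (intro exI[of _ "a + 1"] exI[of _ "map Suc Q @ [1, m + 2]"] exI[of _ "h + 1"]) simp
  qed
qed

text \<open>The last new position gets \<open>p i\<close> where the decreasing block would have
  \<open>n + gap k a k\<close>, which is \<open>n\<close> for \<open>1 \<le> a\<close>. The two
  agree exactly when \<open>p i = n\<close>.\<close>

definition splice_path :: "(nat \<Rightarrow> nat) \<Rightarrow> nat \<Rightarrow> nat \<Rightarrow> nat \<Rightarrow> nat \<Rightarrow> nat \<Rightarrow> nat" where
  "splice_path p n i k a j =
     (if j \<le> n then (if j = i then n + a else p j)
      else if j < n + k then n + gap k a (j - n) else p i)"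

text \<open>With \<open>i\<close> at the end of the list, append the shifted path: \<open>i\<close>
  enters it at \<open>n + a\<close>, and its last point \<open>n + k\<close> leads to the old
  successor of \<open>i\<close>.\<close>

lemma cycle_list_splice:
  assumes "cycle_list p xs" "i \<in> set xs" "set xs \<subseteq> {1..n}" "gap_path k a Q"
  obtains xs' where "cycle_list (splice_path p n i k a) xs'" "set xs' = set xs \<union> (+) n ` set Q"
proof -
  let ?p = "splice_path p n i k a"
  obtain ys where ys: "cycle_list p (ys @ [i])" "set (ys @ [i]) = set xs"
    using cycle_list_ending_in[OF assms(1,2)] .
  obtain h t where ht: "ys @ [i] = h # t" by (cases "ys @ [i]") auto
  have p: "map p ys = t" "p i = h"
  proof -
    have "map p ys @ [p i] = rotate1 (h # t)"
      using ys(1) ht by (metis cycle_list_def list.simps(8,9) map_append)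
    then show "map p ys = t" "p i = h" by auto
  qed
  have Q: "distinct Q" "set Q \<subseteq> {1..k}" "Q \<noteq> []" "hd Q = a" "last Q = k"
    "map (gap k a) (butlast Q) = tl Q"
    using assms(4) by (auto simp: gap_path_def)
  obtain Q' where Q': "Q = Q' @ [k]"
    using Q(3,5) by (metis append_butlast_last_id)
  have "1 \<le> k" using Q(2) Q' by auto
  have "map ?p ys = map p ys"
    using ys assms(3) by (auto simp: splice_path_def cycle_list_def)
  moreover have "?p i = n + hd Q" "?p (n + k) = h"
    using assms(2,3) p Q(4) \<open>1 \<le> k\<close> by (auto simp: splice_path_def)
  moreover have "map ?p (map ((+) n) Q') = map ((+) n) (tl Q)"
  proof -
    have "map ?p (map ((+) n) Q') = map ((+) n) (map (gap k a) Q')"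
      using Q(1,2) Q' by (fastforce simp: splice_path_def)
    then show ?thesis using Q(6) by (simp only: Q' butlast_snoc)
  qed
  moreover have "map ((+) n) Q = map ((+) n) Q' @ [n + k]" by (simp add: Q')
  ultimately have "map ?p ((ys @ [i]) @ map ((+) n) Q) = t @ [n + hd Q] @ map ((+) n) (tl Q) @ [h]"
    using p(1) by (simp only: map_append list.map append_assoc)
  also have "\<dots> = t @ map ((+) n) Q @ [h]" using Q(3) by (cases Q) auto
  also have "\<dots> = rotate1 ((ys @ [i]) @ map ((+) n) Q)" by (simp add: ht)
  finally have "map ?p ((ys @ [i]) @ map ((+) n) Q) = rotate1 ((ys @ [i]) @ map ((+) n) Q)" .
  moreover have "distinct ((ys @ [i]) @ map ((+) n) Q)"
  proof -
    have "set (ys @ [i]) \<inter> set (map ((+) n) Q) = {}"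
      using ys(2) assms(3) Q(2) by fastforce
    then show ?thesis
      using ys(1) Q(1) by (auto simp: cycle_list_def distinct_map)
  qed
  ultimately show ?thesis
    using that[of "(ys @ [i]) @ map ((+) n) Q"] ys(2) by (auto simp: cycle_list_def)
qed

text \<open>\<open>p i \<noteq> i\<close> places \<open>i\<close> on the long cycle, so the fixed
  point survives.\<close>

lemma fixes_and_cycles_splice:
  assumes "fixes_and_cycles n p" "p i \<noteq> i" "i \<in> {1..n}" "gap_path k a Q" "set Q = {1..k}"
  shows "fixes_and_cycles (n + k) (splice_path p n i k a)"
proof -
  obtain f xs where *: "cycle_list p xs" "f \<notin> set xs" "p f = f" "insert f (set xs) = {1..n}"
    using assms by (auto simp: fixes_and_cycles_def)
  have "i \<in> set xs" "set xs \<subseteq> {1..n}" using assms(2,3) *(3,4) by auto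
  from cycle_list_splice[OF *(1) this assms(4)]
  obtain xs' where xs': "cycle_list (splice_path p n i k a) xs'" "set xs' = set xs \<union> (+) n ` {1..k}"
    using assms(5) by metis
  have "(+) n ` {1..k} = {n + 1..n + k}" by (simp add: image_add_atLeastAtMost)
  moreover have "f \<in> {1..n}" "f \<noteq> i" using *(2,3,4) assms(2) by auto
  ultimately have "f \<notin> set xs'" "splice_path p n i k a f = f"
    "insert f (set xs') = {1..n + k}"
    using *(2,3,4) xs'(2) by (auto simp: splice_path_def)
  then show ?thesis
    using xs'(1) unfolding fixes_and_cycles_def by blast
qed

section \<open>Shapes of insertion tableaux\<close>

lemma row_insert_map:
  fixes f :: "'a::linorder \<Rightarrow> 'b::linorder"
  assumes "strict_mono_on A f" "set r \<subseteq> A" "a \<in> A"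
  shows "row_insert (f a) (map f r) = map_prod (map f) (map_option f) (row_insert a r)"
  using assms(2)
  by (induction r) (auto simp: strict_mono_on_less[OF assms(1)] assms(3) split: prod.split)

lemma mset_row_insert:
  "mset (fst (row_insert a r)) + mset_set (set_option (snd (row_insert a r))) = add_mset a (mset r)"
  by (induction r) (auto split: prod.split)

lemma set_row_insert:
  assumes "row_insert a r = (r', c)"
  shows "set r' \<union> set_option c = insert a (set r)"
proof -
  have "set_mset (mset r' + mset_set (set_option c)) = set_mset (add_mset a (mset r))"
    using mset_row_insert[of a r] assms by simp
  then show ?thesis by (cases c) auto
qed

lemma mem_row_insert: "a \<in> set (fst (row_insert a r))"
  by (induction r) (auto split: prod.split)

lemma sorted_row_insert: "sorted r \<Longrightarrow> sorted (fst (row_insert a r))"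
proof (induction r)
  case (Cons b r)
  obtain r' c where r': "row_insert a r = (r', c)" by fastforce
  then have "set r' \<subseteq> insert a (set r)" using set_row_insert by blast
  then show ?case using Cons r' by fastforce
qed simp

lemma row_insert_append:
  assumes "\<And>x. x \<in> set r \<Longrightarrow> x < a"
  shows "row_insert a (r @ s) = map_prod ((@) r) id (row_insert a s)"
  using assms
proof (induction r)
  case (Cons b r)
  have "b < a" using Cons.prems by simp
  then have "\<not> a < b" by order
  then show ?case using Cons by (cases "row_insert a s") auto
qed (cases "row_insert a s", simp)

text \<open>The scan stops at the leftmost entry above \<open>x\<close>, which lies in
  \<open>r\<close>, so nothing to the right of \<open>r\<close> matters.\<close>

lemma row_insert_bump_append:
  assumes "z \<in> set r" "x < z"
  obtains r' b where "row_insert x r = (r', Some b)" "\<And>s. row_insert x (r @ s) = (r' @ s, Some b)"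
proof -
  have "\<exists>r' b. \<forall>s. row_insert x (r @ s) = (r' @ s, Some b)"
    using assms
  proof (induction r)
    case (Cons c r)
    then show ?case by (cases "x < c") auto
  qed simp
  then show ?thesis using that by (metis append_Nil2)
qed

section \<open>Relabelling, content and sortedness of tableaux\<close>

lemma tableau_insert_map:
  fixes f :: "'a::linorder \<Rightarrow> 'b::linorder"
  assumes "strict_mono_on A f" "set (concat T) \<subseteq> A" "a \<in> A"
  shows "tableau_insert (f a) (map (map f) T) = map (map f) (tableau_insert a T)"
  using assms(2,3)
proof (induction T arbitrary: a)
  case (Cons r T)
  obtain r' c where r': "row_insert a r = (r', c)" by fastforce
  then have "set_option c \<subseteq> A" using set_row_insert[OF r'] Cons.prems by auto
  then show ?case
    using Cons r' row_insert_map[OF assms(1), of r a] by (cases c) auto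
qed simp

lemma mset_tableau_insert: "mset (concat (tableau_insert a T)) = add_mset a (mset (concat T))"
proof (induction T arbitrary: a)
  case (Cons r T)
  obtain r' c where r': "row_insert a r = (r', c)" by fastforce
  then show ?case
    using Cons mset_row_insert[of a r]
    by (cases c) (auto simp flip: union_mset_add_mset_left)
qed simp

lemma sorted_tableau_insert:
  assumes "\<forall>r \<in> set T. sorted r"
  shows "\<forall>r \<in> set (tableau_insert a T). sorted r"
  using assms
proof (induction T arbitrary: a)
  case (Cons r T)
  obtain r' c where r': "row_insert a r = (r', c)" by fastforce
  then show ?case
    using Cons sorted_row_insert[of r a] by (cases c) auto
qed simp

lemma insertion_tableau_append:
  "insertion_tableau (xs @ ys) = fold tableau_insert ys (insertion_tableau xs)"
  by (simp add: insertion_tableau_def)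

lemma insertion_tableau_snoc:
  "insertion_tableau (xs @ [x]) = tableau_insert x (insertion_tableau xs)"
  by (simp add: insertion_tableau_def)

lemma insertion_tableau_Nil [simp]: "insertion_tableau [] = []"
  by (simp add: insertion_tableau_def)

lemma mset_insertion_tableau: "mset (concat (insertion_tableau xs)) = mset xs"
  by (induction xs rule: rev_induct) (auto simp: insertion_tableau_snoc mset_tableau_insert)

lemma set_insertion_tableau: "set (concat (insertion_tableau xs)) = set xs"
  by (metis mset_insertion_tableau set_mset_mset)

lemma sorted_insertion_tableau: "r \<in> set (insertion_tableau xs) \<Longrightarrow> sorted r"
proof (induction xs arbitrary: r rule: rev_induct)
  case (snoc x xs)
  then show ?case using sorted_tableau_insert by (metis insertion_tableau_snoc)
qed simp

lemma sum_list_shape_insertion_tableau: "sum_list (shape (insertion_tableau xs)) = length xs"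
  by (metis length_concat mset_insertion_tableau shape_def size_mset)

text \<open>Insertion only compares letters, so raising letters without changing their order keeps
  the shape.\<close>

lemma insertion_tableau_map:
  assumes "strict_mono_on (set xs) f"
  shows "insertion_tableau (map f xs) = map (map f) (insertion_tableau xs)"
  using assms
proof (induction xs rule: rev_induct)
  case (snoc x xs)
  have "strict_mono_on (set xs) f"
    using snoc.prems by (rule monotone_on_subset) auto
  then show ?case
    using snoc.IH tableau_insert_map[OF snoc.prems, of "insertion_tableau xs" x]
    by (simp add: insertion_tableau_snoc set_insertion_tableau[unfolded set_concat] subset_insertI)
qed simp

text \<open>Rows are sorted and the letters distinct, so nothing can follow the largest letter in
  its row.\<close>

lemma insertion_tableau_max_split:
  assumes "distinct xs" "M \<in> set xs" "\<And>x. x \<in> set xs \<Longrightarrow> x \<le> M"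
  obtains pre r post where "insertion_tableau xs = pre @ (r @ [M]) # post"
    "set (concat pre) \<union> set r \<union> set (concat post) = set xs - {M}"
proof -
  let ?T = "insertion_tableau xs"
  have dist: "distinct (concat ?T)"
    using assms(1) by (metis mset_eq_imp_distinct_iff mset_insertion_tableau)
  obtain row where row: "row \<in> set ?T" "M \<in> set row"
    using assms(2) set_insertion_tableau[of xs] by auto
  obtain pre post where T: "?T = pre @ row # post" using split_list[OF row(1)] by blast
  obtain r s where s: "row = r @ M # s" using split_list[OF row(2)] by blast
  have "y = M" if "y \<in> set s" for y
  proof -
    have "M \<le> y" using sorted_insertion_tableau[OF row(1)] that by (simp add: s sorted_append)
    moreover have "y \<in> set (concat ?T)" using that by (simp add: T s)
    ultimately show ?thesis using assms(3) set_insertion_tableau by (metis order.antisym)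
  qed
  moreover have "M \<notin> set s" using dist by (simp add: T s)
  ultimately have "s = []" using last_in_set by metis
  moreover have "set (concat pre) \<union> set r \<union> set (concat post) = set (concat ?T) - {M}"
    using dist unfolding T s \<open>s = []\<close> by auto
  ultimately show ?thesis using that T s by (metis set_insertion_tableau)
qed

text \<open>The entrywise sum of \<open>l\<close> and the partition of \<open>k\<close> into ones,
  where rows past the end of \<open>l\<close> count as 0.\<close>

fun add_column :: "nat \<Rightarrow> nat list \<Rightarrow> nat list" where
  "add_column 0 l = l"
| "add_column (Suc k) [] = 1 # add_column k []"
| "add_column (Suc k) (m # l) = Suc m # add_column k l"

section \<open>Inserting decreasing sequences\<close>

lemma sorted_wrt_butlast: "sorted_wrt P xs \<Longrightarrow> sorted_wrt P (butlast xs)"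
  by (cases xs rule: rev_cases) (auto simp: sorted_wrt_append)

text \<open>The first letter is appended and each later one displaces its predecessor, so the last
  one stays and the others descend in unchanged order.\<close>

lemma fold_tableau_insert_decreasing_row:
  assumes "sorted_wrt (>) D" "D \<noteq> []" "\<And>x d. x \<in> set r \<Longrightarrow> d \<in> set D \<Longrightarrow> x < d"
  shows "fold tableau_insert D (r # T) = (r @ [last D]) # fold tableau_insert (butlast D) T"
  using assms
proof (induction D rule: rev_induct)
  case (snoc d D)
  have d: "row_insert d (r @ s) = map_prod ((@) r) id (row_insert d s)" for s
    using snoc.prems(3) by (intro row_insert_append) auto
  show ?case
  proof (cases "D = []")
    case True
    then show ?thesis using d[of "[]"] by simp
  next
    case False
    then have "d < last D" using snoc.prems(1) by (simp add: sorted_wrt_append)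
    moreover have "fold tableau_insert D (r # T) = (r @ [last D]) # fold tableau_insert (butlast D) T"
      using snoc False by (simp add: sorted_wrt_append)
    moreover have "fold tableau_insert D T = tableau_insert (last D) (fold tableau_insert (butlast D) T)"
      by (subst append_butlast_last_id[OF False, symmetric])
        (simp only: fold_append fold_simps comp_apply)
    ultimately show ?thesis using d[of "[last D]"] by simp
  qed
qed simp

text \<open>Every row keeps one letter, the last of those reaching it, until the sequence is used
  up.\<close>

lemma shape_fold_tableau_insert_decreasing:
  assumes "sorted_wrt (>) D" "\<And>x d. x \<in> set (concat T) \<Longrightarrow> d \<in> set D \<Longrightarrow> x < d"
  shows "shape (fold tableau_insert D T) = add_column (length D) (shape T)"
  using assms
proof (induction D arbitrary: T rule: length_induct)
  case (1 D)
  show ?case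
  proof (cases "D = []")
    case False
    then obtain E d where D: "D = E @ [d]" by (metis rev_exhaust)
    have E: "sorted_wrt (>) E" using "1.prems"(1) by (simp add: D sorted_wrt_append)
    show ?thesis
    proof (cases T)
      case Nil
      \<comment> \<open>For a nonempty word the empty tableau behaves like a single empty row, to
        which the row lemma applies.\<close>
      have "fold tableau_insert D [] = fold tableau_insert D [[]]"
        using False by (cases D) simp_all
      also have "\<dots> = [d] # fold tableau_insert E []"
        using fold_tableau_insert_decreasing_row[OF "1.prems"(1) False, of "[]" "[]"] by (simp add: D)
      finally show ?thesis
        using "1.IH"[rule_format, of E "[]"] E by (simp add: D Nil shape_def)
    next
      case (Cons r T')
      have "fold tableau_insert D T = (r @ [d]) # fold tableau_insert E T'"
        using fold_tableau_insert_decreasing_row[OF "1.prems"(1) False, of r T'] "1.prems"(2)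
        by (simp add: D Cons)
      then show ?thesis
        using "1.IH"[rule_format, of E T'] E "1.prems"(2) by (simp add: D Cons shape_def)
    qed
  qed simp
qed

text \<open>The first letter of \<open>F\<close> bumps \<open>M\<close> and each later one its
  predecessor. So \<open>M\<close> leads the descending sequence and \<open>e\<close> never
  moves.\<close>

lemma fold_tableau_insert_decreasing_below:
  assumes "sorted_wrt (>) F" "F \<noteq> []" "\<And>x d. x \<in> set r \<Longrightarrow> d \<in> set F \<Longrightarrow> x < d"
    "\<And>d. d \<in> set F \<Longrightarrow> d < M"
  shows "fold tableau_insert F ((r @ [M, e]) # T) =
    (r @ [last F, e]) # fold tableau_insert (M # butlast F) T"
  using assms
proof (induction F rule: rev_induct)
  case (snoc d F)
  have d: "row_insert d (r @ s) = map_prod ((@) r) id (row_insert d s)" for s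
    using snoc.prems(3) by (intro row_insert_append) auto
  show ?case
  proof (cases "F = []")
    case True
    then show ?thesis using d[of "[M, e]"] snoc.prems(4) by simp
  next
    case False
    then have "d < last F" using snoc.prems(1) by (simp add: sorted_wrt_append)
    moreover have "fold tableau_insert F ((r @ [M, e]) # T) =
        (r @ [last F, e]) # fold tableau_insert (M # butlast F) T"
      using snoc False by (simp add: sorted_wrt_append)
    moreover have "fold tableau_insert (M # F) T =
        tableau_insert (last F) (fold tableau_insert (M # butlast F) T)"
      by (subst append_butlast_last_id[OF False, symmetric])
        (simp only: append_Cons[symmetric] fold_append fold_simps comp_apply)
    ultimately show ?thesis using d[of "[last F, e]"] by simp
  qed
qed simp

text \<open>Once the letters of \<open>D\<close> above \<open>M\<close> have passed through the row of \<open>M\<close>, one of them stays there,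
  and \<open>M\<close> takes its place in the decreasing sequence entering the next row.\<close>

lemma shape_fold_tableau_insert_decreasing_max:
  assumes "sorted_wrt (>) D" "D \<noteq> [] \<Longrightarrow> M < hd D" "M \<notin> set D"
    "\<And>x d. x \<in> set (concat pre) \<union> set r \<union> set (concat post) \<Longrightarrow> d \<in> insert M (set D) \<Longrightarrow> x < d"
  shows "shape (fold tableau_insert D (pre @ (r @ [M]) # post)) =
    add_column (length D) (shape (pre @ (r @ [M]) # post))"
  using assms
proof (induction pre arbitrary: D)
  case Nil
  show ?case
  proof (cases "D = []")
    case False
    define E where "E = takeWhile (\<lambda>d. M < d) D"
    define F where "F = dropWhile (\<lambda>d. M < d) D"
    have D: "D = E @ F" by (simp add: E_def F_def)
    \<comment> \<open>A letter above \<open>M\<close> is what makes the row of \<open>M\<close>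
      grow.\<close>
    have "E \<noteq> []" using False Nil.prems(2) by (cases D) (auto simp: E_def)
    have sorted: "sorted_wrt (>) E" "sorted_wrt (>) F" "\<forall>e\<in>set E. \<forall>f\<in>set F. f < e"
      using Nil.prems(1) by (auto simp: D sorted_wrt_append)
    have E: "M < e" if "e \<in> set E" for e using set_takeWhileD that unfolding E_def by fastforce
    have F: "f < M" if "f \<in> set F" for f
    proof -
      have "F \<noteq> []" using that by auto
      then have "\<not> M < hd F" "hd F \<in> set F"
        using hd_dropWhile[of "\<lambda>d. M < d" D] by (simp_all add: F_def[symmetric])
      then have "hd F < M" using Nil.prems(3) by (metis D Un_iff antisym_conv3 set_append)
      moreover have "f \<le> hd F" using sorted(2) that by (cases F) auto
      ultimately show ?thesis by order
    qed
    have step: "fold tableau_insert E ((r @ [M]) # post) =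
        (r @ [M, last E]) # fold tableau_insert (butlast E) post"
      using fold_tableau_insert_decreasing_row[OF sorted(1) \<open>E \<noteq> []\<close>, of "r @ [M]" post]
        Nil.prems(4) E by (auto simp: D)
    have sE': "sorted_wrt (>) (butlast E)" using sorted(1) by (rule sorted_wrt_butlast)
    have less: "x < d" if "x \<in> set (concat post)" "d \<in> insert M (set D)" for x d
      using Nil.prems(4) that by blast
    show ?thesis
    proof (cases "F = []")
      case True
      have "shape (fold tableau_insert (butlast E) post) = add_column (length (butlast E)) (shape post)"
        using less by (intro shape_fold_tableau_insert_decreasing sE') (auto simp: D dest: in_set_butlastD)
      moreover have "add_column (length D) (m # l) = Suc m # add_column (length (butlast E)) l" for m l
        using \<open>E \<noteq> []\<close> True by (cases E) (simp_all add: D)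
      ultimately show ?thesis using step True by (simp add: D shape_def del: length_butlast)
    next
      case False
      \<comment> \<open>\<open>last E\<close> and \<open>last F\<close> stay in the row while
        \<open>M\<close> leaves it, so one letter fewer than in \<open>D\<close> goes on. The
        sequence still decreases because \<open>M\<close> lies between \<open>E\<close> and
        \<open>F\<close>.\<close>
      let ?G = "butlast E @ M # butlast F"
      have "fold tableau_insert D ((r @ [M]) # post) =
          fold tableau_insert F ((r @ [M, last E]) # fold tableau_insert (butlast E) post)"
        by (simp add: D step)
      also have "\<dots> = (r @ [last F, last E]) # fold tableau_insert ?G post"
        using fold_tableau_insert_decreasing_below[OF sorted(2) False, of r M] Nil.prems(4) F
        by (simp add: D)
      finally have fold: "fold tableau_insert D ((r @ [M]) # post) =
          (r @ [last F, last E]) # fold tableau_insert ?G post" .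
      have "sorted_wrt (>) (butlast F)" using sorted(2) by (rule sorted_wrt_butlast)
      moreover have "set (butlast E) \<subseteq> set E" "set (butlast F) \<subseteq> set F"
        by (auto dest: in_set_butlastD)
      ultimately have "sorted_wrt (>) ?G"
        using sE' sorted(3) E F by (auto simp: sorted_wrt_append subset_iff)
      then have "shape (fold tableau_insert ?G post) = add_column (length ?G) (shape post)"
        using less by (intro shape_fold_tableau_insert_decreasing) (auto simp: D dest: in_set_butlastD)
      moreover have "add_column (length D) (m # l) = Suc m # add_column (length ?G) l" for m l
        using \<open>E \<noteq> []\<close> False by (cases E; cases F) (simp_all add: D)
      ultimately show ?thesis using fold by (simp add: shape_def del: length_butlast)
    qed
  qed simp
next
  case (Cons q pre)
  show ?case
  proof (cases "D = []")
    case False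
    \<comment> \<open>A row above that of \<open>M\<close> retains only \<open>last D\<close>; the
      head of the sequence, and with it \<open>M < hd D\<close>, survives as long as letters
      remain.\<close>
    have fold: "fold tableau_insert D ((q # pre) @ (r @ [M]) # post) =
        (q @ [last D]) # fold tableau_insert (butlast D) (pre @ (r @ [M]) # post)"
      using fold_tableau_insert_decreasing_row[OF Cons.prems(1) False, of q] Cons.prems(4) by simp
    have "shape (fold tableau_insert (butlast D) (pre @ (r @ [M]) # post)) =
        add_column (length (butlast D)) (shape (pre @ (r @ [M]) # post))"
    proof (rule Cons.IH)
      show "sorted_wrt (>) (butlast D)" using Cons.prems(1) by (rule sorted_wrt_butlast)
      show "M < hd (butlast D)" if "butlast D \<noteq> []"
        using Cons.prems(2) False that by (cases D) (auto split: if_splits)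
      show "M \<notin> set (butlast D)" using Cons.prems(3) by (meson in_set_butlastD)
      show "x < d" if "x \<in> set (concat pre) \<union> set r \<union> set (concat post)"
        "d \<in> insert M (set (butlast D))" for x d
        using Cons.prems(4) that by (auto dest: in_set_butlastD)
    qed
    moreover have "add_column (length D) (m # l) = Suc m # add_column (length (butlast D)) l" for m l
      using False by (cases D) simp_all
    ultimately show ?thesis using fold by (simp add: shape_def del: length_butlast)
  qed simp
qed

text \<open>Letters of \<open>D\<close> may lie on both sides of \<open>M\<close> but exceed all
  others, so the tableau of \<open>xs\<close> is split at the row that \<open>M\<close>
  ends.\<close>

lemma shape_insertion_tableau_append_decreasing:
  assumes "distinct xs" "M \<in> set xs" "\<And>x. x \<in> set xs \<Longrightarrow> x \<le> M"
    "sorted_wrt (>) D" "D \<noteq> []" "M < hd D" "M \<notin> set D"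
    "\<And>x d. x \<in> set xs - {M} \<Longrightarrow> d \<in> set D \<Longrightarrow> x < d"
  shows "shape (insertion_tableau (xs @ D)) = add_column (length D) (shape (insertion_tableau xs))"
proof -
  obtain pre r post where T: "insertion_tableau xs = pre @ (r @ [M]) # post"
    "set (concat pre) \<union> set r \<union> set (concat post) = set xs - {M}"
    using insertion_tableau_max_split[OF assms(1-3)] by blast
  have "x < d" if "x \<in> set xs - {M}" "d \<in> insert M (set D)" for x d
    using assms(3,8) that by (metis DiffE insertE nless_le singletonI)
  then show ?thesis
    using assms(4-7) T(2) unfolding insertion_tableau_append T(1)
    by (intro shape_fold_tableau_insert_decreasing_max) blast+
qed

lemma insertion_tableau_decreasing:
  assumes "sorted_wrt (>) xs"
  shows "insertion_tableau xs = map (\<lambda>x. [x]) (rev xs)"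
  using assms
proof (induction xs rule: rev_induct)
  case (snoc x xs)
  have "insertion_tableau (xs @ [x]) = fold tableau_insert (xs @ [x]) [[]]"
    by (cases xs) (simp_all add: insertion_tableau_def)
  also have "\<dots> = [x] # insertion_tableau xs"
    using fold_tableau_insert_decreasing_row[OF snoc.prems, of "[]" "[]"]
    by (simp add: insertion_tableau_def)
  finally show ?case using snoc by (simp add: sorted_wrt_append)
qed simp

lemma add_column_Nil: "add_column k [] = replicate k 1"
  by (induction k) auto

text \<open>The letter \<open>b\<close> stays in the first row, so it need not exceed the letters of \<open>E\<close>.\<close>

lemma shape_insertion_tableau_two_columns:
  assumes "sorted_wrt (>) (M # E @ [x])" "sorted_wrt (>) (D @ [b])" "D \<noteq> []" "M < hd D" "M \<notin> set D"
    "x < b" "\<And>e d. e \<in> set E \<Longrightarrow> d \<in> set D \<Longrightarrow> e < d"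
  shows "shape (insertion_tableau ((M # E @ [x]) @ (D @ [b]))) =
    add_column (Suc (length D)) (add_column (length E + 2) [])"
proof -
  \<comment> \<open>The column below \<open>x\<close>, written so that its bottom row
    \<open>[M]\<close> has the form with empty \<open>r\<close> and \<open>post\<close>.\<close>
  let ?T = "map (\<lambda>x. [x]) (rev E) @ ([] @ [M]) # []"
  have "insertion_tableau (M # E @ [x]) = [x] # ?T"
    using insertion_tableau_decreasing[OF assms(1)] by simp
  moreover have "x < d" if "d \<in> set (D @ [b])" for d
    using that assms(2,6) by (auto simp: sorted_wrt_append)
  then have "fold tableau_insert (D @ [b]) ([x] # ?T) = [x, b] # fold tableau_insert D ?T"
    using fold_tableau_insert_decreasing_row[OF assms(2), of "[x]" ?T] by simp
  moreover have "shape (fold tableau_insert D ?T) = add_column (length D) (shape ?T)"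
    using assms by (intro shape_fold_tableau_insert_decreasing_max) (auto simp: sorted_wrt_append)
  moreover have "shape ?T = replicate (Suc (length E)) 1"
    by (simp add: shape_def map_replicate_const o_def replicate_append_same)
  ultimately show ?thesis
    unfolding insertion_tableau_append by (simp add: shape_def add_column_Nil)
qed

text \<open>\<open>M\<close> is appended to the first row. As \<open>y\<close> has just entered that
  row, \<open>x\<close> bumps an entry to the left of \<open>M\<close>, just as it would without
  \<open>M\<close>.\<close>

lemma shape_insertion_tableau_insert_max_before_descent:
  assumes "x < y" "\<And>z. z \<in> set (u @ [y, x]) \<Longrightarrow> z < M"
  shows "shape (insertion_tableau (u @ [y, M, x])) = add_column 1 (shape (insertion_tableau (u @ [y, x])))"
proof -
  obtain r T where T: "insertion_tableau (u @ [y]) = r # T"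
    by (metis Nil_is_append_conv concat.simps(1) list.set(1) neq_Nil_conv not_Cons_self2
        set_empty set_insertion_tableau)
  have "y \<in> set r"
    using T mem_row_insert[of y] unfolding insertion_tableau_snoc
    by (cases "insertion_tableau u") (auto split: prod.splits option.splits, (metis fst_conv)+)
  then obtain r' b where b: "row_insert x r = (r', Some b)" "\<And>s. row_insert x (r @ s) = (r' @ s, Some b)"
    using row_insert_bump_append assms(1) by metis
  have "set (concat (r # T)) = set (u @ [y])" using T by (metis set_insertion_tableau)
  then have "row_insert M (r @ []) = map_prod ((@) r) id (row_insert M [])"
    using assms(2) by (intro row_insert_append) auto
  then have "insertion_tableau ((u @ [y]) @ [M, x]) = (r' @ [M]) # tableau_insert b T"
    unfolding insertion_tableau_append[of "u @ [y]"] T by (simp add: b(2))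
  moreover have "insertion_tableau ((u @ [y]) @ [x]) = r' # tableau_insert b T"
    unfolding insertion_tableau_append[of "u @ [y]"] T by (simp add: b(1))
  ultimately show ?thesis by (simp add: shape_def)
qed

section \<open>Adding columns\<close>

lemma gap_less: "i < j \<Longrightarrow> j \<le> k \<Longrightarrow> gap k a j < gap k a i"
  by (auto simp: gap_def)

lemma gap_neq: "1 \<le> a \<Longrightarrow> a \<noteq> gap k a j"
  by (auto simp: gap_def)

lemma gap_self: "1 \<le> a \<Longrightarrow> gap k a k = 0"
  by (simp add: gap_def)

lemma sorted_wrt_map_gap: "sorted_wrt (>) (map (\<lambda>j. n + gap k a j) [1..<Suc k])"
  unfolding sorted_wrt_map
  by (rule sorted_wrt_mono_rel[OF _ sorted_wrt_upt]) (auto simp: gap_less)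

lemma one_line_splice_path:
  assumes "1 \<le> k"
  shows "one_line (n + k) (splice_path p n i k a) =
    map (p(i := n + a)) [1..<Suc n] @ map (\<lambda>j. n + gap k a j) [1..<k] @ [p i]"
proof -
  have "[1..<Suc (n + k)] = [1..<Suc n] @ map (\<lambda>j. j + n) [1..<Suc k]"
    by (rule nth_equalityI) (auto simp: nth_append simp del: upt_Suc)
  also have "[1..<Suc k] = [1..<k] @ [k]" using assms by simp
  finally show ?thesis
    using assms by (auto simp: one_line_def splice_path_def simp del: upt_Suc)
qed

lemma set_one_line:
  assumes "fixes_and_cycles n p"
  shows "set (one_line n p) = {1..n}"
  using fixes_and_cycles_image[OF assms]
  by (simp add: one_line_def atLeastLessThanSuc_atLeastAtMost del: upt_Suc)

text \<open>The final descent is what allows a column of height 1 to be added.\<close>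

definition realizable :: "nat list \<Rightarrow> bool" where
  "realizable l \<longleftrightarrow> (\<exists>n p. 2 \<le> n \<and> fixes_and_cycles n p \<and> p n < p (n - 1) \<and>
     shape (insertion_tableau (one_line n p)) = l)"

text \<open>Raising the largest letter \<open>n\<close> to \<open>n + a\<close> preserves the order
  of the old word, and the displaced \<open>n\<close> completes the decreasing block of new
  letters.\<close>

lemma realizable_add_column_ge_2:
  assumes "realizable l" "2 \<le> k"
  shows "realizable (add_column k l)"
proof -
  obtain n p where p: "2 \<le> n" "fixes_and_cycles n p" "p n < p (n - 1)"
    "shape (insertion_tableau (one_line n p)) = l"
    using assms(1) by (auto simp: realizable_def)
  have im: "p ` {1..n} = {1..n}" and inj: "inj_on p {1..n}"
    using p(2) fixes_and_cycles_image fixes_and_cycles_inj by blast+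
  obtain i where i: "i \<in> {1..n}" "p i = n"
    using im p(1) by (metis atLeastAtMost_iff imageE le_refl one_le_numeral order_trans)
  have "1 \<le> n - 1" using p(1) by arith
  then have "p (n - 1) \<in> {1..n}" using im by auto
  \<comment> \<open>A fixed point \<open>i\<close> would be \<open>n\<close> itself, and the word
    would end in its largest letter, against the final descent.\<close>
  then have "p i \<noteq> i" using i p(3) by auto
  obtain a Q where aQ: "gap_path k a Q" "set Q = {1..k}" "a < k"
    using ex_gap_path[of k] assms(2) by auto
  have "1 \<le> a" using aQ(1) hd_in_set[of Q] by (auto simp: gap_path_def)
  let ?p = "splice_path p n i k a"
  let ?f = "\<lambda>v. if v = n then n + a else v"
  let ?xs = "map ?f (one_line n p)"
  let ?D = "map (\<lambda>j. n + gap k a j) [1..<Suc k]"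
  have set: "set (one_line n p) = {1..n}" using p(2) by (rule set_one_line)
  have dist: "distinct (one_line n p)"
    using inj by (simp add: one_line_def distinct_map atLeastLessThanSuc_atLeastAtMost del: upt_Suc)
  have mono: "strict_mono_on {1..n} ?f"
    by (auto simp: strict_mono_on_def)
  have "map (p(i := n + a)) [1..<Suc n] = ?xs"
  proof -
    have "(p(i := n + a)) j = ?f (p j)" if "j \<in> {1..n}" for j
      using inj i that by (auto dest: inj_onD)
    then show ?thesis by (simp add: one_line_def del: upt_Suc)
  qed
  moreover have "?D = map (\<lambda>j. n + gap k a j) [1..<k] @ [p i]"
    using i(2) \<open>1 \<le> a\<close> assms(2) by (simp add: gap_self)
  ultimately have "one_line (n + k) ?p = ?xs @ ?D"
    using one_line_splice_path[of k n p i a] assms(2) by simp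
  moreover have "shape (insertion_tableau (?xs @ ?D)) = add_column (length ?D) (shape (insertion_tableau ?xs))"
  proof (rule shape_insertion_tableau_append_decreasing[where M = "n + a"])
    have "inj_on ?f (set (one_line n p))"
      using strict_mono_on_imp_inj_on[OF mono] set by simp
    then show "distinct ?xs" using dist by (simp add: distinct_map)
    show "n + a \<in> set ?xs" using p(1) by (auto simp: set)
    show "x \<le> n + a" if "x \<in> set ?xs" for x using that by (auto simp: set)
    show "sorted_wrt (>) ?D" by (rule sorted_wrt_map_gap)
    show "?D \<noteq> []" using assms(2) by simp
    have "hd ?D = n + gap k a 1" using assms(2) by (simp add: upt_conv_Cons del: upt_Suc)
    then show "n + a < hd ?D" using aQ(3) by (simp add: gap_def)
    show "n + a \<notin> set ?D" using gap_neq[OF \<open>1 \<le> a\<close>] by (auto simp del: upt_Suc)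
    show "x < d" if "x \<in> set ?xs - {n + a}" "d \<in> set ?D" for x d
      using that by (auto simp: set split: if_splits)
  qed
  moreover have "shape (insertion_tableau ?xs) = l"
    using p(4) mono insertion_tableau_map[of "one_line n p" ?f] set
    by (simp add: shape_def comp_def)
  moreover have "fixes_and_cycles (n + k) ?p"
    by (rule fixes_and_cycles_splice) fact+
  moreover have "?p (n + k) < ?p (n + k - 1)"
    using i assms(2) gap_less[of "k - 1" k k a] by (auto simp: splice_path_def)
  ultimately show ?thesis
    using assms(2) unfolding realizable_def
    by (intro exI[of _ "n + k"] exI[of _ ?p]) (simp del: upt_Suc)
qed

text \<open>For height 1 the path forces \<open>a = k\<close>, so \<open>n + a\<close> is not below
  the first new letter. Splicing at \<open>n\<close> instead puts \<open>n + 1\<close> between the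
  last two letters, and the word again ends in a descent.\<close>

lemma realizable_add_column_1:
  assumes "realizable l"
  shows "realizable (add_column 1 l)"
proof -
  obtain n p where p: "2 \<le> n" "fixes_and_cycles n p" "p n < p (n - 1)"
    "shape (insertion_tableau (one_line n p)) = l"
    using assms(1) by (auto simp: realizable_def)
  have im: "p ` {1..n} = {1..n}"
    using p(2) fixes_and_cycles_image by blast
  have le: "p j \<le> n" if "j \<in> {1..n}" for j using im that by auto
  have "1 \<le> n - 1" using p(1) by arith
  then have "p n \<noteq> n" using le[of "n - 1"] p(3) by auto
  have Q: "gap_path 1 1 [1]" "set [1::nat] = {1..1}" by (auto simp: gap_path_def)
  let ?p = "splice_path p n n 1 1"
  obtain m where m: "n = Suc (Suc m)" using p(1) that[of "n - 2"] by simp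
  let ?u = "map p [1..<Suc m]"
  have old: "one_line n p = ?u @ [p (n - 1), p n]" by (simp add: one_line_def m)
  have "map (p(n := n + 1)) [1..<Suc n] = ?u @ [p (n - 1), n + 1]" by (simp add: m)
  then have new: "one_line (n + 1) ?p = ?u @ [p (n - 1), n + 1, p n]"
    using one_line_splice_path[of 1 n p n 1] by simp
  have "z < n + 1" if "z \<in> set (?u @ [p (n - 1), p n])" for z
    using that unfolding old[symmetric] set_one_line[OF p(2)] by simp
  then have "shape (insertion_tableau (one_line (n + 1) ?p)) = add_column 1 l"
    using shape_insertion_tableau_insert_max_before_descent[OF p(3), of ?u "n + 1"] p(4) old new
    by (simp del: upt_Suc)
  moreover have "fixes_and_cycles (n + 1) ?p"
    using fixes_and_cycles_splice[OF p(2) \<open>p n \<noteq> n\<close> _ Q] p(1) by simp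
  moreover have "?p (n + 1) < ?p (n + 1 - 1)"
    using le[of n] p(1) by (auto simp: splice_path_def)
  ultimately show ?thesis
    using p(1) unfolding realizable_def by (intro exI[of _ "n + 1"] exI[of _ ?p]) simp
qed

lemma realizable_add_column:
  assumes "realizable l" "1 \<le> k"
  shows "realizable (add_column k l)"
  using assms realizable_add_column_1 realizable_add_column_ge_2 by (cases "k = 1") auto

text \<open>A cyclic permutation whose word becomes decreasing once its first letter is raised.\<close>

lemma ex_cycle_list_column:
  assumes "1 \<le> c"
  shows "\<exists>q xs E b. cycle_list q xs \<and> set xs = {1..c} \<and> q 1 = b \<and>
    (\<forall>M. c < M \<longrightarrow> map (q(1 := M)) [1..<Suc c] = M # E \<and> sorted_wrt (>) (M # E)) \<and>
    (\<forall>e \<in> set E. e \<le> c) \<and> (E = [] \<and> b = 1 \<or> last E < b \<and> E \<noteq> []) \<and> 1 \<le> b \<and> b \<le> c"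
proof (cases "c = 1")
  case True
  then show ?thesis
    by (intro exI[of _ id] exI[of _ "[1]"] exI[of _ "[]"] exI[of _ 1]) (auto simp: cycle_list_def)
next
  case False
  \<comment> \<open>The cycle arises by splicing a path through \<open>s\<close> new points into the
    loop at 1; the word is \<open>1 + a\<close> followed by a decreasing sequence ending in
    1.\<close>
  define s where "s = c - 1"
  have s: "1 \<le> s" "c = 1 + s" using False assms by (auto simp: s_def)
  obtain a Q where aQ: "gap_path s a Q" "set Q = {1..s}"
    using ex_gap_path[OF s(1)] by auto
  have a: "1 \<le> a" "a \<le> s" using aQ hd_in_set[of Q] by (auto simp: gap_path_def)
  let ?q = "splice_path id 1 1 s a"
  have "cycle_list id [1::nat]" by (simp add: cycle_list_def)
  from cycle_list_splice[OF this _ _ aQ(1), of 1 1]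
  obtain xs where xs: "cycle_list ?q xs" "set xs = set [1] \<union> (+) 1 ` set Q" by auto
  let ?E = "map (\<lambda>j. 1 + gap s a j) [1..<Suc s]"
  have E: "?E = map (\<lambda>j. 1 + gap s a j) [1..<s] @ [1]"
    using s(1) a by (simp add: gap_self)
  have "set xs = {1..c}" unfolding xs(2) aQ(2) s(2) by auto
  moreover have "map (?q(1 := M)) [1..<Suc c] = M # ?E" for M
  proof -
    have up: "[1..<Suc c] = 1 # [2..<Suc c]" using assms by (simp add: upt_conv_Cons numeral_2_eq_2 del: upt_Suc)
    have "map ?q [1..<Suc c] =
        map (id(1 := 1 + a)) [1..<Suc 1] @ map (\<lambda>j. 1 + gap s a j) [1..<s] @ [id 1]"
      using one_line_splice_path[OF s(1), of 1 id 1 a] unfolding one_line_def s(2) .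
    also have "\<dots> = (1 + a) # ?E" unfolding E by simp
    finally have "?E = map ?q [2..<Suc c]" unfolding up by (simp del: upt_Suc)
    then show ?thesis unfolding up by (simp del: upt_Suc)
  qed
  moreover have le: "\<forall>e \<in> set ?E. e \<le> c" by (auto simp: gap_def s(2) simp del: upt_Suc)
  moreover have "sorted_wrt (>) (M # ?E)" if "c < M" for M
    using sorted_wrt_map_gap[of 1 s a] le that by (auto simp del: upt_Suc)
  \<comment> \<open>Here \<open>?q 1 = 1 + a\<close> and \<open>last ?E = 1\<close>.\<close>
  moreover have "last ?E < ?q 1" "?q 1 \<le> c" using E a s(2) by (auto simp: splice_path_def)
  moreover have "?E \<noteq> []" unfolding E by simp
  ultimately show ?thesis
    using xs(1) by (intro exI[of _ ?q] exI[of _ xs] exI[of _ ?E] exI[of _ "?q 1"]) (simp del: upt_Suc)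
qed

text \<open>Splicing at 1 makes the first \<open>c\<close> letters and the last \<open>k\<close>
  letters decreasing. All of \<open>{1..c}\<close> lies on the cycle, so the fixed point must come
  from the new block, whence \<open>3 \<le> k\<close>.\<close>

lemma realizable_two_columns:
  assumes "1 \<le> c" "3 \<le> k"
  shows "realizable (add_column k (add_column c []))"
proof -
  obtain q xs E b where q: "cycle_list q xs" "set xs = {1..c}" "q 1 = b"
    "\<And>M. c < M \<Longrightarrow> map (q(1 := M)) [1..<Suc c] = M # E"
    "\<And>M. c < M \<Longrightarrow> sorted_wrt (>) (M # E)"
    "\<And>e. e \<in> set E \<Longrightarrow> e \<le> c" "E = [] \<and> b = 1 \<or> last E < b \<and> E \<noteq> []" "1 \<le> b" "b \<le> c"
    using ex_cycle_list_column[OF assms(1)] by blast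
  obtain a Q h where aQ: "gap_path k a Q" "a < k" "h < k" "h \<notin> set Q" "gap k a h = h"
    "insert h (set Q) = {1..k}"
    using ex_gap_path_fixing[OF assms(2)] by blast
  have a: "1 \<le> a" using aQ(1) hd_in_set[of Q] by (auto simp: gap_path_def)
  let ?p = "splice_path q c 1 k a"
  let ?M = "c + a"
  let ?D = "map (\<lambda>j. c + gap k a j) [1..<k]"
  have "1 \<in> set xs" "set xs \<subseteq> {1..c}" using q(2) assms(1) by auto
  from cycle_list_splice[OF q(1) this aQ(1)]
  obtain ys where ys: "cycle_list ?p ys" "set ys = {1..c} \<union> (+) c ` set Q"
    using q(2) by metis
  have "h \<in> {1..k}" using aQ(6) by blast
  then have "?p (c + h) = c + h" "c + h \<notin> set ys"
    using aQ(3-5) ys(2) by (auto simp: splice_path_def)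
  moreover have "insert (c + h) (set ys) = {1..c + k}"
  proof -
    have "insert (c + h) (set ys) = {1..c} \<union> (+) c ` {1..k}"
      unfolding ys(2) aQ(6)[symmetric] by auto
    also have "\<dots> = {1..c + k}" by (auto simp: image_add_atLeastAtMost)
    finally show ?thesis .
  qed
  ultimately have fc: "fixes_and_cycles (c + k) ?p"
    using ys(1) unfolding fixes_and_cycles_def by blast
  have word: "one_line (c + k) ?p = (?M # E) @ ?D @ [b]"
    using one_line_splice_path[of k c q 1 a] assms(2) q(3) q(4)[of ?M] a by simp
  \<comment> \<open>The last letter is \<open>b\<close> in place of \<open>c\<close>; since
    \<open>b \<le> c\<close>, the block still decreases.\<close>
  have "sorted_wrt (>) (?D @ [c + gap k a k])"
    using sorted_wrt_map_gap[of c k a] assms(2) by simp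
  then have D: "sorted_wrt (>) (?D @ [b])" "\<And>d. d \<in> set ?D \<Longrightarrow> c < d"
    using q(9) gap_self[OF a, of k] by (auto simp: sorted_wrt_append)
  have D': "?D \<noteq> []" "?M < hd ?D" "?M \<notin> set ?D"
    using assms(2) aQ(2) gap_neq[OF a] by (auto simp: hd_map gap_def[of k a "Suc 0"])
  have lenD: "Suc (length ?D) = k" using assms(2) by simp
  have "length E = c - 1"
    using arg_cong[OF q(4)[of ?M], of length] a by (simp del: upt_Suc)
  have "shape (insertion_tableau ((?M # E) @ ?D @ [b])) = add_column k (add_column c [])"
  proof (cases "E = []")
    \<comment> \<open>The first block is the single letter \<open>?M\<close>, so even
      \<open>b < ?M\<close> is harmless: there are no other old letters to exceed.\<close>
    case True
    then have c: "c = 1" "b = 1" using \<open>length E = c - 1\<close> assms(1) q(7) by auto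
    have "shape (insertion_tableau ([?M] @ (?D @ [b]))) =
        add_column (length (?D @ [b])) (shape (insertion_tableau [?M]))"
      using D D' c a
      by (intro shape_insertion_tableau_append_decreasing[where M = ?M]) auto
    then show ?thesis using True lenD c by (simp add: insertion_tableau_def shape_def)
  next
    case False
    define E' x where "E' = butlast E" and "x = last E"
    have E: "E = E' @ [x]" using False by (simp add: E'_def x_def)
    have "shape (insertion_tableau ((?M # E' @ [x]) @ (?D @ [b]))) =
        add_column (Suc (length ?D)) (add_column (length E' + 2) [])"
    proof (rule shape_insertion_tableau_two_columns)
      show "sorted_wrt (>) (?M # E' @ [x])" using q(5)[of ?M] a E by simp
      show "x < b" using q(7) E by simp
      show "e < d" if "e \<in> set E'" "d \<in> set ?D" for e d
        using q(6)[of e] D(2)[OF that(2)] that(1) E by simp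
    qed (use D D' in auto)
    moreover have "length E' + 2 = c" using \<open>length E = c - 1\<close> E assms(1) by simp
    ultimately show ?thesis by (simp only: E lenD)
  qed
  moreover have "?p (c + k) < ?p (c + k - 1)"
    using q(3,9) assms(2) gap_less[of "k - 1" k k a] by (auto simp: splice_path_def)
  ultimately show ?thesis
    using fc assms unfolding realizable_def
    by (intro exI[of _ "c + k"] exI[of _ ?p]) (simp only: word, simp)
qed

text \<open>The base for column heights 2 and 1, where \<open>realizable_two_columns\<close> lacks a
  column of height at least 3.\<close>

lemma realizable_2_1: "realizable [2, 1]"
proof -
  define p :: "nat \<Rightarrow> nat" where "p i = (if i = 1 then 1 else 5 - i)" for i
  have "cycle_list p [2, 3]" "p 1 = 1" "insert 1 (set [2, 3]) = {1..3::nat}"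
    by (auto simp: cycle_list_def p_def)
  then have "fixes_and_cycles 3 p"
    unfolding fixes_and_cycles_def by (intro exI[of _ 1] exI[of _ "[2, 3]"]) auto
  moreover have "shape (insertion_tableau (one_line 3 p)) = [2, 1]"
    by (simp add: one_line_def p_def upt_conv_Cons shape_def insertion_tableau_def)
  ultimately show ?thesis
    unfolding realizable_def by (intro exI[of _ 3] exI[of _ p]) (simp add: p_def)
qed

section \<open>Partitions as sums of columns\<close>

lemma add_column_commute: "add_column j (add_column k l) = add_column k (add_column j l)"
proof (induction j arbitrary: k l)
  case (Suc j)
  then show ?case by (cases k; cases l) simp_all
qed simp

lemma sum_list_add_column: "sum_list (add_column k l) = k + sum_list l"
  by (induction k l rule: add_column.induct) auto

text \<open>The inner list is \<open>l\<close> without its first column: rows of length 1 vanish,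
  and by monotonicity they form the end of \<open>l\<close>.\<close>

lemma add_column_decrement:
  assumes "sorted_wrt (\<ge>) l" "\<forall>x \<in> set l. x > 0"
  shows "add_column (length l) (map (\<lambda>x. x - 1) (filter (\<lambda>x. x > 1) l)) = l"
  using assms
proof (induction l)
  case (Cons x l)
  show ?case
  proof (cases "x > 1")
    case True
    then show ?thesis using Cons by simp
  next
    case False
    then have all: "y = 1" if "y \<in> set (x # l)" for y using Cons.prems that by fastforce
    then have "filter (\<lambda>x. x > 1) (x # l) = []" by (auto simp: filter_empty_conv)
    moreover have "x # l = replicate (length (x # l)) 1" using all by (simp add: replicate_eqI)
    ultimately show ?thesis by (metis add_column_Nil list.map(1))
  qed
qed simp

text \<open>Peel off the first column, of height \<open>length l\<close>, and recurse on the smaller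
  rest.\<close>

lemma partition_eq_columns:
  assumes "is_partition_of l n"
  shows "\<exists>cs. (\<forall>c \<in> set cs. 1 \<le> c) \<and> l = foldr add_column cs []"
  using assms
proof (induction n arbitrary: l rule: less_induct)
  case (less n)
  show ?case
  proof (cases "l = []")
    case True
    then show ?thesis by (intro exI[of _ "[]"]) simp
  next
    case False
    let ?l = "map (\<lambda>x. x - 1) (filter (\<lambda>x. x > 1) l)"
    have l: "sorted_wrt (\<ge>) l" "\<forall>x \<in> set l. x > 0" "sum_list l = n"
      using less.prems by (auto simp: is_partition_of_def)
    have eq: "add_column (length l) ?l = l"
      using add_column_decrement[OF l(1,2)] .
    have "sum_list ?l < n"
      using False l(3) sum_list_add_column[of "length l" ?l] unfolding eq by (cases l) auto
    moreover have "sorted_wrt (\<ge>) ?l"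
      unfolding sorted_wrt_map
      by (rule sorted_wrt_mono_rel[OF _ sorted_wrt_filter[OF l(1)]]) auto
    then have "is_partition_of ?l (sum_list ?l)"
      by (auto simp: is_partition_of_def)
    ultimately obtain cs where "\<forall>c \<in> set cs. 1 \<le> c" "?l = foldr add_column cs []"
      using less.IH by blast
    then show ?thesis
      using eq False by (intro exI[of _ "length l # cs"]) (auto simp: Suc_le_eq)
  qed
qed

lemma foldr_add_column_remove1:
  "c \<in> set cs \<Longrightarrow> foldr add_column cs l = add_column c (foldr add_column (remove1 c cs) l)"
  by (induction cs) (auto simp: add_column_commute)

lemma foldr_add_column_add_column:
  "foldr add_column cs (add_column c l) = add_column c (foldr add_column cs l)"
  by (induction cs) (auto simp: add_column_commute)

lemma realizable_foldr_add_column: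
  "realizable l \<Longrightarrow> \<forall>c \<in> set cs. 1 \<le> c \<Longrightarrow> realizable (foldr add_column cs l)"
  by (induction cs) (auto simp: realizable_add_column)

text \<open>Columns commute, so the chosen two can be built first and the others added afterwards.
  \<open>remove1\<close> ensures two different occurrences even if \<open>c = d\<close>.\<close>

lemma realizable_columns:
  assumes "realizable (add_column c (add_column d []))" "c \<in> set cs" "d \<in> set (remove1 c cs)"
    "\<forall>c \<in> set cs. 1 \<le> c"
  shows "realizable (foldr add_column cs [])"
proof -
  let ?ds = "remove1 d (remove1 c cs)"
  have "foldr add_column cs [] = foldr add_column ?ds (add_column c (add_column d []))"
    using assms(2,3) by (simp add: foldr_add_column_remove1 foldr_add_column_add_column)
  moreover have "\<forall>c \<in> set ?ds. 1 \<le> c"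
    using assms(4) set_remove1_subset by (metis subsetD)
  ultimately show ?thesis using assms(1) realizable_foldr_add_column by metis
qed

lemma foldr_add_column_replicate_1: "0 < m \<Longrightarrow> foldr add_column (replicate m 1) [] = [m]"
proof (induction m)
  case (Suc m)
  then show ?case by (cases "m = 0") auto
qed simp

lemma foldr_add_column_replicate_2: "0 < m \<Longrightarrow> foldr add_column (replicate m 2) [] = [m, m]"
proof (induction m)
  case (Suc m)
  then show ?case by (cases "m = 0") (auto simp: numeral_2_eq_2)
qed simp

lemma realizable_partition:
  assumes "1 \<le> n" "is_partition_of l n" "l \<noteq> [n]" "l \<noteq> replicate n 1"
    "even n \<Longrightarrow> l \<noteq> [n div 2, n div 2]"
  shows "realizable l"
proof -
  obtain cs where cs: "\<forall>c \<in> set cs. 1 \<le> c" "l = foldr add_column cs []"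
    using partition_eq_columns[OF assms(2)] by blast
  have sum: "sum_list l = n" using assms(2) by (simp add: is_partition_of_def)
  have "cs \<noteq> []" using cs(2) sum assms(1) by auto
  show ?thesis
  proof (cases "\<exists>k \<in> set cs. 3 \<le> k")
    case True
    then obtain k where k: "k \<in> set cs" "3 \<le> k" by blast
    \<comment> \<open>Otherwise \<open>l\<close> would be a single column.\<close>
    have "remove1 k cs \<noteq> []"
    proof
      assume "remove1 k cs = []"
      then have "l = replicate k 1"
        using foldr_add_column_remove1[OF k(1), of "[]"] cs(2) by (simp add: add_column_Nil)
      then show False using assms(4) sum by (simp add: sum_list_replicate)
    qed
    then obtain c where c: "c \<in> set (remove1 k cs)" by (metis last_in_set)
    then have "1 \<le> c" using cs(1) by (meson notin_set_remove1)
    then show ?thesis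
      using realizable_columns[OF realizable_two_columns k(1) c cs(1)] k(2) cs(2) by simp
  next
    case False
    then have cs12: "c = 1 \<or> c = 2" if "c \<in> set cs" for c using that cs(1) by fastforce
    \<comment> \<open>Only heights 1 and 2 remain. If both occur they form the base
      \<open>[2, 1]\<close>; all ones give a single row and all twos give two equal rows, both
      excluded.\<close>
    consider "1 \<in> set cs" "2 \<in> set cs" | "set cs \<subseteq> {1}" | "set cs \<subseteq> {2}"
      using cs12 by blast
    then show ?thesis
    proof cases
      case 1
      have "add_column 2 (add_column 1 []) = [2, 1]" by (simp add: numeral_2_eq_2)
      then show ?thesis
        using realizable_columns[of 2 1 cs] realizable_2_1 1 cs by simp
    next
      case 2
      then have "cs = replicate (length cs) 1" by (intro replicate_eqI) auto
      then have "l = [length cs]"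
        using foldr_add_column_replicate_1[of "length cs"] \<open>cs \<noteq> []\<close> cs(2) by simp
      then show ?thesis using assms(3) sum by simp
    next
      case 3
      then have "cs = replicate (length cs) 2" by (intro replicate_eqI) auto
      then have "l = [length cs, length cs]"
        using foldr_add_column_replicate_2[of "length cs"] \<open>cs \<noteq> []\<close> cs(2) by simp
      then show ?thesis using assms(5) sum by auto
    qed
  qed
qed

lemma realizable_imp_almost_cyclic:
  assumes "realizable l" "sum_list l = n"
  shows "\<exists>\<sigma>. almost_cyclic n \<sigma> \<and> shape (insertion_tableau (one_line n \<sigma>)) = l"
proof -
  obtain m p where p: "fixes_and_cycles m p" "shape (insertion_tableau (one_line m p)) = l"
    using assms(1) by (auto simp: realizable_def)
  \<comment> \<open>Each inserted letter adds one cell, so the size of the shape is the length of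
    the word.\<close>
  have "m = n"
    using assms(2) p(2) sum_list_shape_insertion_tableau[of "one_line m p"]
    by (simp add: one_line_def del: upt_Suc)
  then show ?thesis using almost_cyclic_if_fixes_and_cycles[OF p(1)] p(2) by metis
qed

theorem theorem4p2:
  fixes n :: nat
  assumes "n \<ge> 1"
  shows "(odd n \<longrightarrow>
           (\<forall>l. is_partition_of l n \<and> l \<noteq> [n] \<and> l \<noteq> replicate n 1 \<longrightarrow>
             (\<exists>\<sigma>. almost_cyclic n \<sigma> \<and> shape (insertion_tableau (one_line n \<sigma>)) = l))) \<and>
         (even n \<longrightarrow>
           (\<forall>l. is_partition_of l n \<and> l \<noteq> [n] \<and> l \<noteq> replicate n 1 \<and> l \<noteq> [n div 2, n div 2] \<longrightarrow>
             (\<exists>\<sigma>. almost_cyclic n \<sigma> \<and> shape (insertion_tableau (one_line n \<sigma>)) = l)))"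
  using realizable_partition[OF assms] realizable_imp_almost_cyclic
  unfolding is_partition_of_def by blast

end
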